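(* There is a universal constant $c>0$ such that the following holds. For any integer $T>c$ and integers $n,d$ with $d>cT$ and $n>cT^2\log(T)$, for every deterministic algorithm that interacts for $T$ rounds with the two-sided oracle and then outputs $\mathbf{w}_{T+1}\in\mathbb{R}^d$, there exists a matrix $A\in\mathbb{R}^{n\times d}$ satisfying \[ \max_{l\in[n]}\|A_l\|_2\le 1\qquad\text{and}\qquad \max_{\mathbf{w}:\|\mathbf{w}\|_2\le 1}\ \min_{\mathbf{p}\in\Delta^{n-1}}\mathbf{p}^\top A\mathbf{w}\ \ge\ \frac{1}{cT\sqrt{T\log(n)}}, \] yet the algorithm's output after $T$ rounds of interaction with $\mathcal{O}_2^A$ satisfies $\min_{\mathbf{p}\in\Delta^{n-1}}\mathbf{p}^\top A\mathbf{w}_{T+1}\le 0$.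
   Context: $\Delta^{n-1}=\{\mathbf{p}\in\mathbb{R}^n:\ p_i\ge0,\ \sum_ip_i=1\}$; $A_l$ is the $l$-th row of $A$; $\log$ is the natural logarithm. The two-sided oracle $\mathcal{O}_2^A$: given a query $(\mathbf{p},\mathbf{w})\in\mathbb{R}^n\times\mathbb{R}^d$ (arbitrary vectors, not restricted to the simplex or unit ball), it returns $A\mathbf{w}$ and $\mathbf{p}^\top A$. A deterministic algorithm interacting with the oracle for $T$ rounds chooses, at each round $t=1,\dots,T$, a query $(\mathbf{p}_t,\mathbf{w}_t)$ as a deterministic function of the responses from rounds $1,\dots,t-1$, and after round $T$ outputs $\mathbf{w}_{T+1}\in\mathbb{R}^d$ as a deterministic function of all responses. *)

theory Defs
  imports Complex_Main
begin

text \<open>Vectors in R^k are represented as functions nat => real, only the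
coordinates below k being meaningful. An n x d matrix is nat => nat => real,
A l j being the entry in row l < n, column j < d.\<close>

type_synonym vec = "nat \<Rightarrow> real"
type_synonym mat = "nat \<Rightarrow> nat \<Rightarrow> real"

text \<open>Oracle response: (A w, p^T A), padded with zeros outside the index range.\<close>
type_synonym response = "vec \<times> vec"

definition mat_vec :: "nat \<Rightarrow> nat \<Rightarrow> mat \<Rightarrow> vec \<Rightarrow> vec" where
  "mat_vec n d A w = (\<lambda>l. if l < n then (\<Sum>j<d. A l j * w j) else 0)"

definition vec_mat :: "nat \<Rightarrow> nat \<Rightarrow> vec \<Rightarrow> mat \<Rightarrow> vec" where
  "vec_mat n d p A = (\<lambda>j. if j < d then (\<Sum>l<n. p l * A l j) else 0)"

definition bilin :: "nat \<Rightarrow> nat \<Rightarrow> vec \<Rightarrow> mat \<Rightarrow> vec \<Rightarrow> real" where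
  "bilin n d p A w = (\<Sum>l<n. \<Sum>j<d. p l * A l j * w j)"

definition norm2 :: "nat \<Rightarrow> vec \<Rightarrow> real" where
  "norm2 k v = sqrt (\<Sum>j<k. (v j)\<^sup>2)"

definition simplex :: "nat \<Rightarrow> vec set" where
  "simplex n = {p. (\<forall>i<n. p i \<ge> 0) \<and> (\<Sum>i<n. p i) = 1 \<and> (\<forall>i\<ge>n. p i = 0)}"

definition oracle2 :: "nat \<Rightarrow> nat \<Rightarrow> mat \<Rightarrow> vec \<times> vec \<Rightarrow> response" where
  "oracle2 n d A q = (mat_vec n d A (snd q), vec_mat n d (fst q) A)"

text \<open>A deterministic algorithm: a query rule mapping the history of past
responses (in order) to the next query (p_t, w_t), and an output rule mapping
the full history to w_{T+1}.  The history after t rounds:\<close>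
fun history :: "(response list \<Rightarrow> vec \<times> vec) \<Rightarrow> nat \<Rightarrow> nat \<Rightarrow> mat \<Rightarrow> nat \<Rightarrow> response list" where
  "history qry n d A 0 = []"
| "history qry n d A (Suc t) =
     (let hs = history qry n d A t in hs @ [oracle2 n d A (qry hs)])"

definition alg_output :: "(response list \<Rightarrow> vec \<times> vec) \<Rightarrow> (response list \<Rightarrow> vec)
    \<Rightarrow> nat \<Rightarrow> nat \<Rightarrow> mat \<Rightarrow> nat \<Rightarrow> vec" where
  "alg_output qry out n d A T = out (history qry n d A T)"

end

theory Submission
  imports Defs
begin

text \<open>
  Treat the output as one more query, so that there are \<open>N = T + 1\<close> rounds. The adversary builds
  \<open>A = \<Sum>\<^sub>i a\<^sub>i u\<^sub>i\<^sup>T\<close> with one new orthonormal direction \<open>u\<^sub>i\<close> per round, obtained from \<open>w\<^sub>i\<close> by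
  Gram-Schmidt. The columns are \<open>a\<^sub>i = (r\<^sub>i - r\<^sub>i\<^sub>+\<^sub>1) / C\<close>, where \<open>r\<^sub>0\<close> is the all-ones vector and
  each later \<open>r\<^sub>j\<close> lives on its own block of \<open>N + 1\<close> rows, is orthogonal to all \<open>p\<close>-queries
  made so far, and has a maximal entry equal to \<open>N\<close>. Later rank-one terms are then invisible to
  earlier queries. Averaging the rows holding the maximal entries gives \<open>q\<close> in the simplex with
  \<open>q \<cdot> r\<^sub>j = 1\<close> for all \<open>j\<close>, hence \<open>q \<cdot> a\<^sub>i = 0\<close> for every column the algorithm has touched.
  After the last round one adds the column \<open>r\<^sub>N / C\<close>: the columns now telescope to \<open>r\<^sub>0 / C\<close>, so
  \<open>\<Sum>\<^sub>i u\<^sub>i\<close> has the same positive margin on every row.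
\<close>

section \<open>Inner product and its link to the given notions\<close>

definition dot :: "nat \<Rightarrow> vec \<Rightarrow> vec \<Rightarrow> real" where
  "dot k x y = (\<Sum>j<k. x j * y j)"

lemma dot_commute: "dot k x y = dot k y x"
  by (simp add: dot_def mult.commute)

lemma dot_add_left: "dot k (\<lambda>j. x j + y j) z = dot k x z + dot k y z"
  by (simp add: dot_def distrib_right sum.distrib)

lemma dot_diff_left: "dot k (\<lambda>j. x j - y j) z = dot k x z - dot k y z"
  by (simp add: dot_def left_diff_distrib sum_subtractf)

lemma dot_scale_left: "dot k (\<lambda>j. c * x j) z = c * dot k x z"
  by (simp add: dot_def sum_distrib_left mult.assoc)

lemma dot_divide_left: "dot k (\<lambda>j. x j / c) z = dot k x z / c"
  by (simp add: dot_def sum_divide_distrib)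

lemma dot_sum_left: "dot k (\<lambda>j. \<Sum>i\<in>I. f i j) z = (\<Sum>i\<in>I. dot k (f i) z)"
  unfolding dot_def by (subst sum.swap) (simp add: sum_distrib_right)

lemma dot_self_nonneg: "dot k x x \<ge> 0"
  by (simp add: dot_def sum_nonneg)

lemma dot_self_eq_0_iff: "dot k x x = 0 \<longleftrightarrow> (\<forall>j<k. x j = 0)"
  by (auto simp: dot_def sum_nonneg_eq_0_iff)

lemma norm2_eq_sqrt_dot: "norm2 k x = sqrt (dot k x x)"
  by (simp add: norm2_def dot_def power2_eq_square)

lemma mat_vec_eq_dot: "mat_vec n d A w = (\<lambda>l. if l < n then dot d (A l) w else 0)"
  by (simp add: mat_vec_def dot_def fun_eq_iff)

lemma bilin_eq_dot: "bilin n d p A w = (\<Sum>l<n. p l * dot d (A l) w)"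
  by (simp add: bilin_def dot_def sum_distrib_left mult.assoc)

section \<open>Linear algebra: orthogonal vectors with prescribed features\<close>

text \<open>Gaussian elimination, one equation per induction step: the last equation is used to
  eliminate a pivot unknown \<open>e\<close>, leaving \<open>k\<close> equations in the unknowns
  \<open>S - {e}\<close>.\<close>

lemma homogeneous_system_nontrivial_solution:
  fixes f :: "nat \<Rightarrow> nat \<Rightarrow> real"
  assumes "finite S" "k < card S"
  shows "\<exists>x. (\<exists>l\<in>S. x l \<noteq> 0) \<and> (\<forall>l. l \<notin> S \<longrightarrow> x l = 0) \<and> (\<forall>i<k. (\<Sum>l\<in>S. f i l * x l) = 0)"
  using assms
proof (induction k arbitrary: S f)
  case 0
  then obtain l where "l \<in> S" by fastforce
  then show ?case by (intro exI[of _ "\<lambda>i. if i = l then 1 else 0"]) auto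
next
  case (Suc k)
  show ?case
  proof (cases "\<forall>l\<in>S. f k l = 0")
    case True
    obtain x where "\<exists>l\<in>S. x l \<noteq> 0" "\<forall>l. l \<notin> S \<longrightarrow> x l = 0" "\<forall>i<k. (\<Sum>l\<in>S. f i l * x l) = 0"
      using Suc.IH[of S f] Suc.prems by auto
    with True show ?thesis by (intro exI[of _ x]) (auto simp: less_Suc_eq)
  next
    case False
    then obtain e where e: "e \<in> S" "f k e \<noteq> 0" by auto
    define g where "g i l = f i l - f i e * f k l / f k e" for i l
    have fin: "finite (S - {e})" using Suc.prems by simp
    have "k < card (S - {e})" using Suc.prems e by simp
    then obtain y where y: "\<exists>l\<in>S-{e}. y l \<noteq> 0" "\<forall>l. l \<notin> S - {e} \<longrightarrow> y l = 0"
      "\<forall>i<k. (\<Sum>l\<in>S-{e}. g i l * y l) = 0"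
      using Suc.IH[OF fin, of g] by blast
    define s where "s = (\<Sum>l\<in>S-{e}. f k l * y l)"
    \<comment> \<open>The value at \<open>e\<close> is forced by equation \<open>k\<close>;
      \<open>s\<close> is what the other unknowns contribute to it.\<close>
    define x where "x = y(e := - s / f k e)"
    have sum_x: "(\<Sum>l\<in>S. f i l * x l) = f i e * (- s / f k e) + (\<Sum>l\<in>S-{e}. f i l * y l)" for i
    proof -
      have "(\<Sum>l\<in>S-{e}. f i l * x l) = (\<Sum>l\<in>S-{e}. f i l * y l)"
        by (intro sum.cong) (auto simp: x_def)
      then show ?thesis
        using sum.remove[OF Suc.prems(1) e(1), of "\<lambda>l. f i l * x l"] by (simp add: x_def)
    qed
    have sum_g: "(\<Sum>l\<in>S-{e}. g i l * y l) = (\<Sum>l\<in>S-{e}. f i l * y l) - f i e * s / f k e" for i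
      by (simp add: g_def s_def left_diff_distrib sum_subtractf sum_distrib_left sum_divide_distrib
          mult.assoc)
    have "(\<Sum>l\<in>S. f i l * x l) = 0" if "i < Suc k" for i
    proof (cases "i = k")
      case True
      then show ?thesis using e sum_x[of k] by (simp add: s_def)
    next
      case False
      then show ?thesis using that y(3) sum_x[of i] sum_g[of i] by simp
    qed
    moreover have "\<exists>l\<in>S. x l \<noteq> 0" using y(1) by (auto simp: x_def)
    moreover have "\<forall>l. l \<notin> S \<longrightarrow> x l = 0" using y(2) e by (auto simp: x_def)
    ultimately show ?thesis by blast
  qed
qed

text \<open>A nontrivial solution is rescaled by an entry of largest absolute value. Dividing by
  that entry with its sign makes the extreme value \<open>+M\<close> rather than
  \<open>-M\<close>.\<close>

lemma exists_orthogonal_with_max_entry: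
  fixes f :: "nat \<Rightarrow> vec"
  assumes "S \<subseteq> {..<n}" "k < card S" "M \<ge> 0"
  shows "\<exists>x. (\<forall>l. l \<notin> S \<longrightarrow> x l = 0) \<and> (\<forall>l. \<bar>x l\<bar> \<le> M) \<and> (\<exists>l\<in>S. x l = M) \<and>
             (\<forall>i<k. dot n (f i) x = 0)"
proof -
  have fin: "finite S" using assms(1) finite_subset by blast
  obtain y where y: "\<exists>l\<in>S. y l \<noteq> 0" "\<forall>l. l \<notin> S \<longrightarrow> y l = 0" "\<forall>i<k. (\<Sum>l\<in>S. f i l * y l) = 0"
    using homogeneous_system_nontrivial_solution[OF fin assms(2), of f] by blast
  obtain e where e: "e \<in> S" "\<And>l. l \<in> S \<Longrightarrow> \<bar>y l\<bar> \<le> \<bar>y e\<bar>"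
  proof -
    have "Max ((\<lambda>l. \<bar>y l\<bar>) ` S) \<in> (\<lambda>l. \<bar>y l\<bar>) ` S" using fin y(1) by (intro Max_in) auto
    then obtain e where "e \<in> S" "\<bar>y e\<bar> = Max ((\<lambda>l. \<bar>y l\<bar>) ` S)" by force
    then show thesis using that[of e] fin by simp
  qed
  have ye: "y e \<noteq> 0" using y(1) e(2) by fastforce
  define x where "x = (\<lambda>l. M / y e * y l)"
  have "\<bar>x l\<bar> \<le> M" for l
  proof (cases "l \<in> S")
    case True
    have "\<bar>x l\<bar> = M * (\<bar>y l\<bar> / \<bar>y e\<bar>)" using assms(3) by (simp add: x_def abs_mult)
    also have "\<dots> \<le> M * 1" using e(2)[OF True] ye assms(3) by (intro mult_left_mono) auto
    finally show ?thesis by simp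
  qed (use y(2) assms(3) in \<open>auto simp: x_def\<close>)
  moreover have "dot n (f i) x = 0" if "i < k" for i
  proof -
    have "dot n (f i) y = (\<Sum>l\<in>S. f i l * y l)"
      unfolding dot_def by (rule sum.mono_neutral_right) (use assms(1) y(2) in auto)
    with y(3) that have "dot n y (f i) = 0" by (simp add: dot_commute)
    then show ?thesis by (simp add: dot_commute[of n "f i"] x_def dot_divide_left dot_scale_left)
  qed
  moreover have "x e = M" using ye by (simp add: x_def)
  moreover have "x l = 0" if "l \<notin> S" for l using y(2) that by (simp add: x_def)
  ultimately show ?thesis using e(1) by blast
qed

lemma exists_unit_orthogonal:
  fixes u :: "nat \<Rightarrow> vec"
  assumes "k < d"
  shows "\<exists>v. dot d v v = 1 \<and> (\<forall>i<k. dot d v (u i) = 0)"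
proof -
  obtain x where x: "\<exists>l\<in>{..<d}. x l \<noteq> 0" "\<forall>i<k. (\<Sum>l<d. u i l * x l) = 0"
    using homogeneous_system_nontrivial_solution[of "{..<d}" k u] assms by auto
  have pos: "dot d x x > 0"
    using x(1) dot_self_nonneg[of d x] dot_self_eq_0_iff[of d x] by fastforce
  define v where "v = (\<lambda>j. x j / sqrt (dot d x x))"
  have v: "dot d v z = dot d x z / sqrt (dot d x x)" for z
    by (simp add: v_def dot_divide_left)
  have "dot d v v = 1"
    using pos by (simp add: v dot_commute[of d x v])
  moreover have "dot d v (u i) = 0" if "i < k" for i
    using x(2) that by (simp add: v) (simp add: dot_def mult.commute)
  ultimately show ?thesis by blast
qed

text \<open>The last conjunct says that \<open>w\<close> lies in the span of \<open>u\<^sub>0, \<dots>, u\<^sub>k\<^sub>-\<^sub>1, v\<close>.\<close>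
lemma gram_schmidt_step:
  fixes u :: "nat \<Rightarrow> vec"
  assumes "k < d"
    and orth: "\<forall>i<k. \<forall>j<k. dot d (u i) (u j) = (if i = j then 1 else 0)"
  shows "\<exists>v. dot d v v = 1 \<and> (\<forall>i<k. dot d v (u i) = 0) \<and>
    (\<forall>z. (\<forall>i<k. dot d z (u i) = 0) \<and> dot d z v = 0 \<longrightarrow> dot d z w = 0)"
proof -
  define x where "x = (\<lambda>j. w j - (\<Sum>i<k. dot d (u i) w * u i j))"
  have z_x: "dot d x z = dot d w z - (\<Sum>i<k. dot d (u i) w * dot d (u i) z)" for z
    by (simp add: x_def dot_diff_left dot_sum_left dot_scale_left)
  have x_u: "dot d x (u i) = 0" if "i < k" for i
  proof -
    have "(\<Sum>j<k. dot d (u j) w * dot d (u j) (u i)) = (\<Sum>j<k. if j = i then dot d (u j) w else 0)"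
      using orth that by (intro sum.cong) auto
    then show ?thesis using that by (simp add: z_x dot_commute)
  qed
  have z_w: "dot d z w = dot d x z" if "\<forall>i<k. dot d z (u i) = 0" for z
    using that z_x[of z] by (simp add: dot_commute[of d "u _" z] dot_commute[of d w z])
  show ?thesis
  proof (cases "dot d x x = 0")
    case True
    then have "dot d x z = 0" for z
      unfolding dot_self_eq_0_iff by (simp add: dot_def)
    \<comment> \<open>Here \<open>w\<close> already lies in the span of the earlier
      \<open>u i\<close>, so any unit vector orthogonal to them serves.\<close>
    then show ?thesis using exists_unit_orthogonal[OF assms(1), of u] z_w by metis
  next
    case False
    then have pos: "dot d x x > 0" using dot_self_nonneg[of d x] by simp
    define v where "v = (\<lambda>j. x j / sqrt (dot d x x))"
    have v: "dot d v z = dot d x z / sqrt (dot d x x)" for z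
      by (simp add: v_def dot_divide_left)
    have "dot d v v = 1"
      using pos by (simp add: v dot_commute[of d x v])
    moreover have "dot d z w = 0" if "\<forall>i<k. dot d z (u i) = 0" "dot d z v = 0" for z
      using that pos z_w[of z] v[of z] by (simp add: dot_commute[of d z v])
    moreover have "\<forall>i<k. dot d v (u i) = 0" by (simp add: v x_u)
    ultimately show ?thesis by blast
  qed
qed

section \<open>Interaction histories under changes of the matrix or of the query rule\<close>

text \<open>The update changes the two responses by \<open>a\<close> times \<open>dot d u w\<close>
  and by \<open>u\<close> times \<open>dot n p a\<close>. Orthogonality is assumed only for the
  queries made against the old matrix \<open>A\<close>; the induction shows that the new matrix
  provokes the same ones.\<close>

lemma history_add_rank_one:
  assumes "\<forall>s<k. dot n (fst (qry (history qry n d A s))) a = 0"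
    and "\<forall>s<k. dot d u (snd (qry (history qry n d A s))) = 0"
    and "t \<le> k"
  shows "history qry n d (\<lambda>l j. A l j + a l * u j) t = history qry n d A t"
  using assms(3)
proof (induction t)
  case (Suc t)
  define q where "q = qry (history qry n d A t)"
  have p: "dot n (fst q) a = 0" and w: "dot d u (snd q) = 0"
    using assms(1,2) Suc.prems by (auto simp: q_def)
  have "mat_vec n d (\<lambda>l j. A l j + a l * u j) (snd q) = mat_vec n d A (snd q)"
    using w by (simp add: mat_vec_eq_dot dot_add_left dot_scale_left fun_eq_iff)
  moreover have "vec_mat n d (fst q) (\<lambda>l j. A l j + a l * u j) = vec_mat n d (fst q) A"
  proof -
    have "(\<Sum>l<n. fst q l * (A l j + a l * u j)) = (\<Sum>l<n. fst q l * A l j) + dot n (fst q) a * u j" for j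
      by (simp add: dot_def distrib_left sum.distrib sum_distrib_right mult.assoc)
    then show ?thesis using p by (simp add: vec_mat_def fun_eq_iff)
  qed
  ultimately show ?case
    using Suc by (simp add: Let_def oracle2_def q_def)
qed simp

lemma length_history: "length (history qry n d A t) = t"
  by (induction t) (auto simp: Let_def)

text \<open>Allows the query rule to be extended beyond round \<open>T\<close>, so that the output
  can become one more query.\<close>

lemma history_cong:
  assumes "\<And>hs. length hs < T \<Longrightarrow> qry' hs = qry hs" "t \<le> T"
  shows "history qry' n d A t = history qry n d A t"
  using assms(2) by (induction t) (auto simp: Let_def length_history assms(1))

section \<open>The adversary: a telescoping matrix built round by round\<close>

text \<open>The coefficients of the directions \<open>u i\<close> telescope: their sum in row
  \<open>l\<close> is \<open>(r 0 l - r k l) / C\<close>.\<close>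

definition tele_mat :: "real \<Rightarrow> nat \<Rightarrow> (nat \<Rightarrow> vec) \<Rightarrow> (nat \<Rightarrow> vec) \<Rightarrow> mat" where
  "tele_mat C k r u = (\<lambda>l j. \<Sum>i<k. (r i l - r (Suc i) l) / C * u i j)"

lemma tele_mat_extend:
  "tele_mat C (Suc k) (r(Suc k := x)) (u(k := v)) =
     (\<lambda>l j. tele_mat C k r u l j + (r k l - x l) / C * v j)"
  by (simp add: tele_mat_def fun_eq_iff)

lemma dot_tele_mat:
  "dot d (tele_mat C k r u l) w = (\<Sum>i<k. (r i l - r (Suc i) l) / C * dot d (u i) w)"
  unfolding tele_mat_def dot_sum_left dot_scale_left ..

text \<open>The size \<open>Suc N\<close> exceeds by one the largest number of orthogonality
  constraints, \<open>N\<close>, ever imposed on a vector supported on a block.\<close>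

definition block :: "nat \<Rightarrow> nat \<Rightarrow> nat set" where
  "block N j = {j * Suc N ..< Suc j * Suc N}"

lemma block_disjoint: "l \<in> block N i \<Longrightarrow> l \<in> block N j \<Longrightarrow> i = j"
proof -
  have "l \<in> block N i \<Longrightarrow> l div Suc N = i" for i
    by (rule div_nat_eqI) (auto simp: block_def mult.commute)
  then show "l \<in> block N i \<Longrightarrow> l \<in> block N j \<Longrightarrow> i = j" by metis
qed

text \<open>The adversary's state after \<open>k\<close> rounds; rounds are numbered from 0, and \<open>r (Suc j)\<close>
  lives on block \<open>j\<close>. The last conjunct says that the \<open>w\<close>-query of round \<open>s\<close> is in the span of
  \<open>u\<^sub>0, \<dots>, u\<^sub>s\<close>.\<close>
definition resisting ::
  "(response list \<Rightarrow> vec \<times> vec) \<Rightarrow> nat \<Rightarrow> nat \<Rightarrow> nat \<Rightarrow> real \<Rightarrow> nat \<Rightarrow> (nat \<Rightarrow> vec) \<Rightarrow> (nat \<Rightarrow> vec) \<Rightarrow> bool"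
  where
  "resisting qry n d N C k r u \<longleftrightarrow>
     r 0 = (\<lambda>_. 1) \<and>
     (\<forall>i<k. \<forall>j<k. dot d (u i) (u j) = (if i = j then 1 else 0)) \<and>
     (\<forall>j<k. (\<forall>l. l \<notin> block N j \<longrightarrow> r (Suc j) l = 0) \<and> (\<forall>l. \<bar>r (Suc j) l\<bar> \<le> real N) \<and>
            (\<exists>l\<in>block N j. r (Suc j) l = real N)) \<and>
     (\<forall>j<k. \<forall>s\<le>j. dot n (fst (qry (history qry n d (tele_mat C k r u) s))) (r (Suc j)) = 0) \<and>
     (\<forall>s<k. \<forall>z. (\<forall>i\<le>s. dot d z (u i) = 0) \<longrightarrow>
            dot d z (snd (qry (history qry n d (tele_mat C k r u) s))) = 0)"

text \<open>The new term has column \<open>(r k - x) / C\<close> and direction \<open>v\<close>.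
  Earlier \<open>p\<close>-queries miss \<open>r k\<close> by the invariant and \<open>x\<close> by
  hypothesis; earlier \<open>w\<close>-queries lie in the span of the old directions, which
  \<open>v\<close> misses.\<close>

lemma resisting_history_extend:
  assumes R: "resisting qry n d N C k r u"
    and x: "\<forall>s<k. dot n (fst (qry (history qry n d (tele_mat C k r u) s))) x = 0"
    and v: "\<forall>i<k. dot d v (u i) = 0"
    and "t \<le> k"
  shows "history qry n d (tele_mat C (Suc k) (r(Suc k := x)) (u(k := v))) t =
         history qry n d (tele_mat C k r u) t"
  unfolding tele_mat_extend
proof (rule history_add_rank_one[where k = k and a = "\<lambda>l. (r k l - x l) / C"])
  \<comment> \<open>For \<open>k = 0\<close> there is no earlier round; this matters because
    \<open>r 0\<close> is not orthogonal to anything by construction.\<close>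
  have "dot n (fst (qry (history qry n d (tele_mat C k r u) s))) (r k) = 0" if "s < k" for s
    using R that unfolding resisting_def by (cases k) auto
  then show "\<forall>s<k. dot n (fst (qry (history qry n d (tele_mat C k r u) s))) (\<lambda>l. (r k l - x l) / C) = 0"
    using x by (simp add: dot_commute[of n "fst _"] dot_divide_left dot_diff_left)
  show "\<forall>s<k. dot d v (snd (qry (history qry n d (tele_mat C k r u) s))) = 0"
    using R v unfolding resisting_def by auto
qed (fact assms(4))

text \<open>The query of round \<open>k\<close> depends only on earlier responses, so it can be read
  off the current matrix before the adversary chooses \<open>v\<close> and \<open>x\<close> to suit
  it.\<close>

lemma resisting_step:
  assumes R: "resisting qry n d N C k r u" and "k < N" "k < d" "N * Suc N \<le> n"
  shows "\<exists>r u. resisting qry n d N C (Suc k) r u"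
proof -
  define Q where "Q s = qry (history qry n d (tele_mat C k r u) s)" for s
  have r0: "r 0 = (\<lambda>_. 1)"
    and orth: "\<forall>i<k. \<forall>j<k. dot d (u i) (u j) = (if i = j then 1 else 0)"
    and blk: "\<forall>j<k. (\<forall>l. l \<notin> block N j \<longrightarrow> r (Suc j) l = 0) \<and> (\<forall>l. \<bar>r (Suc j) l\<bar> \<le> real N) \<and>
            (\<exists>l\<in>block N j. r (Suc j) l = real N)"
    and rp: "\<forall>j<k. \<forall>s\<le>j. dot n (fst (Q s)) (r (Suc j)) = 0"
    and uw: "\<forall>s<k. \<forall>z. (\<forall>i\<le>s. dot d z (u i) = 0) \<longrightarrow> dot d z (snd (Q s)) = 0"
    using R unfolding resisting_def Q_def by auto
  obtain v where v: "dot d v v = 1" "\<forall>i<k. dot d v (u i) = 0"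
    "\<forall>z. (\<forall>i<k. dot d z (u i) = 0) \<and> dot d z v = 0 \<longrightarrow> dot d z (snd (Q k)) = 0"
    using gram_schmidt_step[OF assms(3) orth, of "snd (Q k)"] by blast
  have "Suc k * Suc N \<le> N * Suc N" using assms(2) by (intro mult_le_mono1) simp
  then have sub: "block N k \<subseteq> {..<n}" using assms(4) by (auto simp: block_def)
  have "card (block N k) = Suc N" by (simp add: block_def)
  \<comment> \<open>The \<open>k + 1\<close> constraints include the current \<open>p\<close>-query,
    so that the next column, which contains \<open>x\<close>, will be invisible to it.\<close>
  then have "Suc k < card (block N k)" using assms(2) by simp
  from exists_orthogonal_with_max_entry[OF sub this, of "real N" "\<lambda>s. fst (Q s)"]
  obtain x where x: "\<forall>l. l \<notin> block N k \<longrightarrow> x l = 0" "\<forall>l. \<bar>x l\<bar> \<le> real N"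
    "\<exists>l\<in>block N k. x l = real N" "\<forall>s<Suc k. dot n (fst (Q s)) x = 0"
    by auto
  define r' u' where "r' = r(Suc k := x)" and "u' = u(k := v)"
  \<comment> \<open>The case \<open>s = k\<close> is included: the new term may alter the response
    in round \<open>k\<close>, but not the query.\<close>
  have hist: "qry (history qry n d (tele_mat C (Suc k) r' u') s) = Q s" if "s \<le> k" for s
    unfolding r'_def u'_def Q_def
    by (subst resisting_history_extend[OF R _ v(2) that]) (use x(4) in \<open>auto simp: Q_def\<close>)
  have "resisting qry n d N C (Suc k) r' u'"
    unfolding resisting_def
  proof (intro conjI)
    show "r' 0 = (\<lambda>_. 1)" using r0 by (simp add: r'_def)
    show "\<forall>i<Suc k. \<forall>j<Suc k. dot d (u' i) (u' j) = (if i = j then 1 else 0)"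
      using orth v(1,2) by (auto simp: u'_def less_Suc_eq dot_commute[of d "u _" v])
    show "\<forall>j<Suc k. (\<forall>l. l \<notin> block N j \<longrightarrow> r' (Suc j) l = 0) \<and> (\<forall>l. \<bar>r' (Suc j) l\<bar> \<le> real N) \<and>
            (\<exists>l\<in>block N j. r' (Suc j) l = real N)"
      using blk x(1-3) by (auto simp: r'_def less_Suc_eq)
    show "\<forall>j<Suc k. \<forall>s\<le>j. dot n (fst (qry (history qry n d (tele_mat C (Suc k) r' u') s))) (r' (Suc j)) = 0"
    proof (intro allI impI)
      fix j s assume "j < Suc k" "s \<le> j"
      then show "dot n (fst (qry (history qry n d (tele_mat C (Suc k) r' u') s))) (r' (Suc j)) = 0"
        using rp x(4) hist[of s] by (cases "j = k") (auto simp: r'_def)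
    qed
    show "\<forall>s<Suc k. \<forall>z. (\<forall>i\<le>s. dot d z (u' i) = 0) \<longrightarrow>
            dot d z (snd (qry (history qry n d (tele_mat C (Suc k) r' u') s))) = 0"
    proof (intro allI impI)
      fix s z assume s: "s < Suc k" and z: "\<forall>i\<le>s. dot d z (u' i) = 0"
      show "dot d z (snd (qry (history qry n d (tele_mat C (Suc k) r' u') s))) = 0"
      proof (cases "s = k")
        case True
        have "dot d z (u i) = 0" if "i < k" for i
          using z[rule_format, of i] True that by (simp add: u'_def)
        moreover have "dot d z v = 0" using z True by (auto simp: u'_def)
        ultimately show ?thesis using v(3) True by (simp add: hist)
      next
        case False
        then have "\<forall>i\<le>s. dot d z (u i) = 0" using z s by (auto simp: u'_def split: if_splits)
        then show ?thesis using uw False s by (simp add: hist)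
      qed
    qed
  qed
  then show ?thesis by blast
qed

lemma resisting_exists:
  assumes "k \<le> N" "N \<le> d" "N * Suc N \<le> n"
  shows "\<exists>r u. resisting qry n d N C k r u"
  using assms(1)
proof (induction k)
  case 0
  show ?case by (intro exI[of _ "\<lambda>_ _. 1"]) (simp add: resisting_def)
next
  case (Suc k)
  then obtain r u where "resisting qry n d N C k r u" by auto
  then show ?case using resisting_step Suc.prems assms(2,3) by (metis Suc_le_eq less_le_trans)
qed

section \<open>Estimates for row norms and averages over rows\<close>

text \<open>A row belongs to at most one block, so at most one summand is nonzero.\<close>

lemma sum_squares_disjoint_blocks:
  fixes r :: "nat \<Rightarrow> vec"
  assumes "\<forall>j<k. \<forall>l. l \<notin> block N j \<longrightarrow> r j l = 0" "\<forall>j<k. \<forall>l. \<bar>r j l\<bar> \<le> M"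
  shows "(\<Sum>j<k. (r j l)\<^sup>2) \<le> M\<^sup>2"
proof (cases "\<exists>b<k. l \<in> block N b")
  case True
  then obtain b where b: "b < k" "l \<in> block N b" by blast
  have "r j l = 0" if "j < k" "j \<noteq> b" for j
    using assms(1) block_disjoint[OF b(2)] that by metis
  then have "(\<Sum>j<k. (r j l)\<^sup>2) = (\<Sum>j\<in>{b}. (r j l)\<^sup>2)"
    using b(1) by (intro sum.mono_neutral_right) auto
  also have "\<dots> \<le> M\<^sup>2"
    using power_mono[of "\<bar>r b l\<bar>" M 2] assms(2) b(1) by simp
  finally show ?thesis .
next
  case False
  then have "(\<Sum>j<k. (r j l)\<^sup>2) = 0" using assms(1) by (intro sum.neutral) auto
  then show ?thesis by simp
qed

text \<open>By \<open>(a - b)^2 \<le> 2 * a^2 + 2 * b^2\<close>, and since each \<open>f i\<close>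
  occurs in at most two differences.\<close>

lemma sum_squared_differences_le:
  fixes f :: "nat \<Rightarrow> real"
  assumes "f (Suc N) = 0"
  shows "(\<Sum>i<Suc N. (f i - f (Suc i))\<^sup>2) \<le> 4 * ((f 0)\<^sup>2 + (\<Sum>j<N. (f (Suc j))\<^sup>2))"
proof -
  have sq: "(a - b)\<^sup>2 \<le> 2 * a\<^sup>2 + 2 * b\<^sup>2" for a b :: real
    using zero_le_power2[of "a + b"] by (simp add: power2_sum power2_diff)
  have "(\<Sum>i<Suc N. (f i - f (Suc i))\<^sup>2) \<le> (\<Sum>i<Suc N. 2 * (f i)\<^sup>2 + 2 * (f (Suc i))\<^sup>2)"
    by (intro sum_mono sq)
  also have "\<dots> = 2 * (\<Sum>i<Suc N. (f i)\<^sup>2) + 2 * (\<Sum>i<Suc N. (f (Suc i))\<^sup>2)"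
    by (simp only: sum.distrib sum_distrib_left)
  also have "(\<Sum>i<Suc N. (f i)\<^sup>2) = (f 0)\<^sup>2 + (\<Sum>j<N. (f (Suc j))\<^sup>2)"
    by (rule sum.lessThan_Suc_shift)
  also have "(\<Sum>i<Suc N. (f (Suc i))\<^sup>2) = (\<Sum>j<N. (f (Suc j))\<^sup>2)"
    using assms by simp
  also have "2 * ((f 0)\<^sup>2 + (\<Sum>j<N. (f (Suc j))\<^sup>2)) + 2 * (\<Sum>j<N. (f (Suc j))\<^sup>2)
      \<le> 4 * ((f 0)\<^sup>2 + (\<Sum>j<N. (f (Suc j))\<^sup>2))" by simp
  finally show ?thesis .
qed

lemma dot_uniform_on_points:
  fixes L :: "nat \<Rightarrow> nat" and f :: vec
  assumes "\<forall>i<N. L i < n"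
  shows "(\<Sum>l<n. (\<Sum>i<N. if l = L i then 1 / real N else 0) * f l) = (\<Sum>i<N. f (L i)) / real N"
proof -
  have "(\<Sum>l<n. (\<Sum>i<N. if l = L i then 1 / real N else 0) * f l)
      = (\<Sum>i<N. \<Sum>l<n. if l = L i then f l / real N else 0)"
    by (subst sum.swap) (simp add: sum_distrib_right if_distrib[of "\<lambda>x. x * _"] cong: if_cong)
  also have "\<dots> = (\<Sum>i<N. f (L i) / real N)"
    using assms by (intro sum.cong) auto
  finally show ?thesis by (simp add: sum_divide_distrib)
qed

section \<open>The completed matrix: large margin, yet a useless last query\<close>

text \<open>Concerns a game of \<open>N\<close> rounds whose last \<open>w\<close>-query, in round
  \<open>N - 1\<close>, will play the part of the output.\<close>

lemma resisting_matrix: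
  fixes qry :: "response list \<Rightarrow> vec \<times> vec" and N n d :: nat
  assumes "N > 0" "N < d" "N * Suc N \<le> n"
  shows "\<exists>A. (\<forall>l<n. norm2 d (A l) \<le> 1) \<and>
     (\<exists>w. norm2 d w \<le> 1 \<and>
        (\<forall>p\<in>simplex n. bilin n d p A w = 1 / (2 * real (Suc N) * sqrt (real (Suc N))))) \<and>
     (\<exists>p\<in>simplex n. bilin n d p A (snd (qry (history qry n d A (N - 1)))) = 0)"
proof -
  \<comment> \<open>Chosen for the row norms:
    \<open>4 * (1 + N^2) \<le> (2 * (N + 1))^2\<close>.\<close>
  define C where "C = 2 * real (Suc N)"
  have C: "C > 0" by (simp add: C_def)
  obtain r0 u0 where R: "resisting qry n d N C N r0 u0"
    using resisting_exists[of N N d n qry C] assms by auto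
  have r0_0: "r0 0 = (\<lambda>_. 1)"
    and orth0: "\<forall>i<N. \<forall>j<N. dot d (u0 i) (u0 j) = (if i = j then 1 else 0)"
    and blk: "\<forall>j<N. \<forall>l. l \<notin> block N j \<longrightarrow> r0 (Suc j) l = 0"
    and bound: "\<forall>j<N. \<forall>l. \<bar>r0 (Suc j) l\<bar> \<le> real N"
    and "\<forall>j<N. \<exists>l\<in>block N j. r0 (Suc j) l = real N"
    and uw: "\<forall>s<N. \<forall>z. (\<forall>i\<le>s. dot d z (u0 i) = 0) \<longrightarrow>
            dot d z (snd (qry (history qry n d (tele_mat C N r0 u0) s))) = 0"
    using R unfolding resisting_def by auto
  then obtain L where L: "\<forall>j<N. L j \<in> block N j \<and> r0 (Suc j) (L j) = real N" by metis
  obtain v where v: "dot d v v = 1" "\<forall>i<N. dot d v (u0 i) = 0"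
    using exists_unit_orthogonal[OF assms(2), of u0] by blast
  \<comment> \<open>Setting \<open>r (Suc N)\<close> to zero makes the final column
    \<open>r N / C\<close>, which ends the telescoping; \<open>N < d\<close> leaves room for its
    direction \<open>v\<close>.\<close>
  define r u where "r = r0(Suc N := (\<lambda>_. 0))" and "u = u0(N := v)"
  define A where "A = tele_mat C (Suc N) r u"
  have r_0: "r 0 l = 1" and r_last: "r (Suc N) l = 0" for l
    by (simp_all add: r_def r0_0)
  have r_eq: "r (Suc j) = r0 (Suc j)" if "j < N" for j
    using that by (simp add: r_def)
  have orth: "dot d (u i) (u j) = (if i = j then 1 else 0)" if "i < Suc N" "j < Suc N" for i j
    using orth0 v that by (auto simp: u_def less_Suc_eq dot_commute[of d "u0 _" v])
  have A_dot: "dot d (A l) w = (\<Sum>i<Suc N. (r i l - r (Suc i) l) / C * dot d (u i) w)" for l w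
    unfolding A_def by (rule dot_tele_mat)
  have A_u: "dot d (A l) (u i) = (r i l - r (Suc i) l) / C" if "i < Suc N" for i l
  proof -
    have "dot d (A l) (u i) = (\<Sum>j<Suc N. if j = i then (r j l - r (Suc j) l) / C else 0)"
      unfolding A_dot using that by (intro sum.cong) (auto simp: orth)
    then show ?thesis using that by (simp del: sum.lessThan_Suc)
  qed
  have hist: "history qry n d A t = history qry n d (tele_mat C N r0 u0) t" if "t \<le> N" for t
    unfolding A_def r_def u_def
    by (rule resisting_history_extend[OF R _ v(2) that]) (simp add: dot_def)

  have rows: "norm2 d (A l) \<le> 1" for l
  proof -
    have "dot d (A l) (A l) = (\<Sum>i<Suc N. ((r i l - r (Suc i) l) / C)\<^sup>2)"
      unfolding A_dot[of l "A l"]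
      by (intro sum.cong) (simp_all add: dot_commute[of d "u _"] A_u power2_eq_square)
    also have "\<dots> = (\<Sum>i<Suc N. (r i l - r (Suc i) l)\<^sup>2) / C\<^sup>2"
      by (simp only: power_divide sum_divide_distrib)
    also have "\<dots> \<le> 4 * (1 + (real N)\<^sup>2) / C\<^sup>2"
    proof (rule divide_right_mono)
      have "(\<Sum>j<N. (r (Suc j) l)\<^sup>2) \<le> (real N)\<^sup>2"
        using sum_squares_disjoint_blocks[of N N "\<lambda>j. r (Suc j)"] blk bound by (simp add: r_eq)
      then show "(\<Sum>i<Suc N. (r i l - r (Suc i) l)\<^sup>2) \<le> 4 * (1 + (real N)\<^sup>2)"
        using sum_squared_differences_le[of "\<lambda>i. r i l" N] by (simp add: r_0 r_last del: sum.lessThan_Suc)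
    qed simp
    also have "\<dots> \<le> 1"
    proof -
      have "4 * (1 + (real N)\<^sup>2) \<le> C\<^sup>2" by (simp add: C_def power2_eq_square algebra_simps)
      then show ?thesis using C by (simp add: divide_le_eq_1)
    qed
    finally show ?thesis by (simp add: norm2_eq_sqrt_dot)
  qed

  \<comment> \<open>A unit vector with equal components along all \<open>N + 1\<close> directions,
    so each row of \<open>A\<close> meets it in a telescoping sum.\<close>
  define w where "w = (\<lambda>j. (\<Sum>i<Suc N. u i j) / sqrt (real (Suc N)))"
  have w_dot: "dot d w z = (\<Sum>i<Suc N. dot d (u i) z) / sqrt (real (Suc N))" for z
    unfolding w_def dot_divide_left dot_sum_left ..
  have w_u: "dot d (u i) w = 1 / sqrt (real (Suc N))" if "i < Suc N" for i
  proof -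
    have "(\<Sum>j<Suc N. dot d (u j) (u i)) = (\<Sum>j<Suc N. if j = i then 1 else 0)"
      using that by (intro sum.cong) (auto simp: orth)
    then show ?thesis using that by (simp add: dot_commute[of d _ w] w_dot del: sum.lessThan_Suc)
  qed
  have "dot d w w = 1"
  proof -
    have "(\<Sum>i<Suc N. dot d (u i) w) = (\<Sum>i<Suc N. 1 / sqrt (real (Suc N)))"
      by (intro sum.cong) (auto simp: w_u)
    then show ?thesis by (simp add: w_dot del: sum.lessThan_Suc of_nat_Suc)
  qed
  then have w_norm: "norm2 d w \<le> 1" by (simp add: norm2_eq_sqrt_dot)
  have "dot d (A l) w = 1 / (C * sqrt (real (Suc N)))" for l
  proof -
    have "dot d (A l) w = (\<Sum>i<Suc N. (r i l - r (Suc i) l) / C * (1 / sqrt (real (Suc N))))"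
      unfolding A_dot by (intro sum.cong) (auto simp: w_u)
    also have "\<dots> = (\<Sum>i<Suc N. r i l - r (Suc i) l) / C * (1 / sqrt (real (Suc N)))"
      by (simp only: sum_distrib_right sum_divide_distrib)
    also have "(\<Sum>i<Suc N. r i l - r (Suc i) l) = 1"
      using sum_lessThan_telescope'[of "\<lambda>i. r i l" "Suc N"] by (simp only: r_0 r_last diff_zero)
    finally show ?thesis by simp
  qed
  then have margin: "bilin n d p A w = 1 / (C * sqrt (real (Suc N)))" if "p \<in> simplex n" for p
    using that by (simp add: bilin_eq_dot sum_distrib_right[symmetric] sum_divide_distrib[symmetric] simplex_def)

  \<comment> \<open>The uniform average of the rows \<open>L i\<close> at which the maximal entries
    sit.\<close>
  define q where "q l = (\<Sum>i<N. if l = L i then 1 / real N else 0)" for l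
  have L_n: "\<forall>i<N. L i < n"
  proof (intro allI impI)
    fix i assume i: "i < N"
    then have "L i < Suc i * Suc N" using L by (auto simp: block_def)
    also have "\<dots> \<le> N * Suc N" using i by (intro mult_le_mono1) simp
    finally show "L i < n" using assms(3) by simp
  qed
  have q_dot: "(\<Sum>l<n. q l * f l) = (\<Sum>i<N. f (L i)) / real N" for f
    unfolding q_def by (rule dot_uniform_on_points[OF L_n])
  have "q \<in> simplex n"
    using q_dot[of "\<lambda>_. 1"] assms(1) L_n
    by (auto simp: simplex_def q_def intro!: sum_nonneg sum.neutral)
  moreover have "bilin n d q A (snd (qry (history qry n d A (N - 1)))) = 0"
  proof -
    define z where "z = snd (qry (history qry n d A (N - 1)))"
    \<comment> \<open>The last query lies in the span of the first \<open>N\<close> directions, so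
      the final column does not act on it.\<close>
    have "dot d v z = 0"
      using uw v(2) assms(1) by (simp add: z_def hist)
    then have A_z: "dot d (A l) z = (\<Sum>i<N. (r i l - r (Suc i) l) / C * dot d (u i) z)" for l
      by (simp add: A_dot u_def)
    \<comment> \<open>For \<open>r 0\<close> this adds \<open>N\<close> ones; for
      \<open>r (Suc b)\<close> only the row \<open>L b\<close> contributes, with the maximal entry
      \<open>N\<close>. Hence \<open>q\<close> cannot tell \<open>r i\<close> from
      \<open>r (Suc i)\<close> when \<open>i < N\<close>.\<close>
    have r_sum: "(\<Sum>j<N. r i (L j)) = real N" if "i \<le> N" for i
    proof (cases i)
      case 0
      then show ?thesis by (simp add: r_0)
    next
      case (Suc b)
      then have b: "b < N" using that by simp
      have "(\<Sum>j<N. r i (L j)) = (\<Sum>j<N. if j = b then real N else 0)"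
        using L b blk block_disjoint by (intro sum.cong) (auto simp: Suc r_eq, metis)
      then show ?thesis using b by simp
    qed
    have "(\<Sum>j<N. dot d (A (L j)) z) = (\<Sum>i<N. \<Sum>j<N. (r i (L j) - r (Suc i) (L j)) / C * dot d (u i) z)"
      unfolding A_z by (rule sum.swap)
    also have "\<dots> = (\<Sum>i<N. ((\<Sum>j<N. r i (L j)) - (\<Sum>j<N. r (Suc i) (L j))) / C * dot d (u i) z)"
      by (simp only: sum_distrib_right sum_divide_distrib sum_subtractf[symmetric])
    also have "\<dots> = 0"
      by (intro sum.neutral) (auto simp: r_sum)
    finally show ?thesis
      unfolding z_def[symmetric] bilin_eq_dot q_dot by simp
  qed
  ultimately show ?thesis
    using rows w_norm margin unfolding C_def by blast
qed

section \<open>Constants and the reduction from output to query\<close>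

text \<open>With \<open>N = T + 1\<close> there are \<open>T + 2\<close> directions. The constant is
  8 times 2, from \<open>2 * (T + 2) \<le> 8 * T\<close> and
  \<open>T + 2 \<le> 4 * T * ln n\<close>; the logarithm only weakens the bound.\<close>

lemma margin_bound:
  fixes T n :: nat
  assumes "T > 0" "ln (real n) \<ge> 1"
  shows "1 / (16 * real T * sqrt (real T * ln (real n)))
    \<le> 1 / (2 * real (Suc (Suc T)) * sqrt (real (Suc (Suc T))))"
proof (rule divide_left_mono)
  have T: "2 * real (Suc (Suc T)) \<le> 8 * real T" using assms(1) by simp
  have "real (Suc (Suc T)) \<le> 4 * (real T * 1)" using assms(1) by simp
  also have "\<dots> \<le> 4 * (real T * ln (real n))"
    using assms by (intro mult_left_mono) auto
  finally have "sqrt (real (Suc (Suc T))) \<le> 2 * sqrt (real T * ln (real n))"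
    by (simp add: real_le_lsqrt real_sqrt_mult[of 4, simplified, symmetric] flip: real_sqrt_mult)
  then have "2 * real (Suc (Suc T)) * sqrt (real (Suc (Suc T)))
      \<le> (8 * real T) * (2 * sqrt (real T * ln (real n)))"
    using assms by (intro mult_mono[OF T]) auto
  then show "2 * real (Suc (Suc T)) * sqrt (real (Suc (Suc T)))
      \<le> 16 * real T * sqrt (real T * ln (real n))" by simp
  show "0 < 16 * real T * sqrt (real T * ln (real n)) * (2 * real (Suc (Suc T)) * sqrt (real (Suc (Suc T))))"
    using assms by simp
qed simp

theorem theorem2:
  shows "\<exists>c::real. c > 0 \<and>
    (\<forall>T n d :: nat. real T > c \<longrightarrow> real d > c * real T \<longrightarrow>
        real n > c * (real T)\<^sup>2 * ln (real T) \<longrightarrow>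
      (\<forall>(qry :: response list \<Rightarrow> vec \<times> vec) (out :: response list \<Rightarrow> vec).
        \<exists>A :: mat.
          (\<forall>l<n. norm2 d (A l) \<le> 1) \<and>
          (\<exists>w. norm2 d w \<le> 1 \<and>
             (\<forall>p\<in>simplex n. bilin n d p A w \<ge> 1 / (c * real T * sqrt (real T * ln (real n))))) \<and>
          (\<exists>p\<in>simplex n. bilin n d p A (alg_output qry out n d A T) \<le> 0)))"
proof (intro exI[of _ "16::real"] conjI allI impI)
  fix T n d :: nat and qry :: "response list \<Rightarrow> vec \<times> vec" and out :: "response list \<Rightarrow> vec"
  assume T: "real T > 16" and d: "real d > 16 * real T"
    and n: "real n > 16 * (real T)\<^sup>2 * ln (real T)"
  have ln_ge_1: "ln x \<ge> 1" if "x \<ge> 16" for x :: real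
    using that exp_le by (subst ln_ge_iff) auto
  have "16 * (real T)\<^sup>2 * 1 \<le> 16 * (real T)\<^sup>2 * ln (real T)"
    using T ln_ge_1 by (intro mult_left_mono) auto
  with n have n_sq: "real n > 16 * (real T)\<^sup>2" by simp
  \<comment> \<open>With \<open>N = Suc T\<close>, the \<open>N\<close> blocks of
    \<open>N + 1\<close> rows must fit into the \<open>n\<close> rows.\<close>
  have "real (Suc T * Suc (Suc T)) \<le> (2 * real T) * (2 * real T)"
    unfolding of_nat_mult using T by (intro mult_mono) auto
  also have "\<dots> \<le> 16 * (real T)\<^sup>2" by (simp add: power2_eq_square)
  also have "\<dots> \<le> real n" using n_sq by simp
  finally have size: "Suc T * Suc (Suc T) \<le> n" by (simp only: of_nat_le_iff)
  have "Suc T * 1 \<le> Suc T * Suc (Suc T)" by (intro mult_le_mono2) simp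
  then have "ln (real n) \<ge> 1" using size T by (intro ln_ge_1) simp
  then have bound: "1 / (16 * real T * sqrt (real T * ln (real n)))
      \<le> 1 / (2 * real (Suc (Suc T)) * sqrt (real (Suc (Suc T))))"
    using T by (intro margin_bound) auto
  \<comment> \<open>The output becomes the \<open>w\<close>-query of round \<open>T\<close>, counted
    from 0; its \<open>p\<close>-part is the zero vector, which is orthogonal to everything.\<close>
  define qry' where "qry' hs = (if length hs < T then qry hs else (\<lambda>_. 0, out hs))" for hs
  have hist: "history qry' n d A T = history qry n d A T" for A
    by (rule history_cong) (auto simp: qry'_def)
  have last_query: "snd (qry' (history qry' n d A (Suc T - 1))) = alg_output qry out n d A T" for A
    by (simp add: hist qry'_def length_history alg_output_def)
  have "Suc T < d" using T d by linarith
  from resisting_matrix[OF _ this size, of qry', unfolded last_query]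
  show "\<exists>A :: mat.
          (\<forall>l<n. norm2 d (A l) \<le> 1) \<and>
          (\<exists>w. norm2 d w \<le> 1 \<and>
             (\<forall>p\<in>simplex n. bilin n d p A w \<ge> 1 / (16 * real T * sqrt (real T * ln (real n))))) \<and>
          (\<exists>p\<in>simplex n. bilin n d p A (alg_output qry out n d A T) \<le> 0)"
    using bound by (metis order_refl zero_less_Suc)
qed simp

end
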